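(* Let $K$ be a field, $S=K[x_1,\ldots,x_n]$, let $M$ be a finitely generated graded $S$-module and $f_1,\ldots,f_m$ a minimal system of homogeneous generators of $M$. Let $F=\bigoplus_{i=1}^m Se_i$ be the free $S$-module with basis $e_1,\ldots,e_m$, let $\varphi:F\to M$ be the homomorphism of $S$-modules with $\varphi(e_i)=f_i$, and let $C=\operatorname{Ker}(\varphi)$. Fix a monomial order $<$ on $S$ and let $<$ also denote the order on the monomials of $F$ defined by: $ue_i<ve_j$ if $i<j$, or $i=j$ and $u<v$ ($u,v$ monomials of $S$). Set $I_j=(f_1,\ldots,f_{j-1}):f_j$ for $1\le j\le m$. Then: (a) $\operatorname{in}_<(C)=\bigoplus_{j=1}^m \operatorname{in}_<(I_j)e_j$. (b) If the (minimal monomial) generators of $\operatorname{in}_<(C)$ are all of the form $ue_i$ with $\deg u\leq 1$, then $M$ has linear quotients.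
   Context: $S=K[x_1,\ldots,x_n]$ has the standard grading. Given a system of generators $g_1,\ldots,g_r$ of $M$, $(g_1,\ldots,g_{j-1}):g_j=\{h\in S: hg_j\in(g_1,\ldots,g_{j-1})\}$, where $(g_1,\ldots,g_{j-1})$ is the submodule generated by $g_1,\ldots,g_{j-1}$ (zero for $j=1$). $M$ has linear quotients with respect to $g_1,\ldots,g_r$ if for each $j$ the ideal $(g_1,\ldots,g_{j-1}):g_j$ is either $S$ or generated by linear forms (the zero ideal is allowed); $M$ has linear quotients if it does so with respect to some system of generators. Monomials of $F$ are the elements $ue_i$ with $u$ a monomial of $S$; $\operatorname{in}_<(C)$ is the submodule of $F$ generated by the leading monomials of the nonzero elements of $C$. *)

theory Defs
  imports Complex_Main "HOL-Library.Poly_Mapping"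
begin

type_synonym 'x monom = "'x \<Rightarrow>\<^sub>0 nat"
type_synonym ('x, 'k) mpoly = "('x \<Rightarrow>\<^sub>0 nat) \<Rightarrow>\<^sub>0 'k"

definition mdeg :: "'x monom \<Rightarrow> nat" where
  "mdeg t = (\<Sum>x\<in>Poly_Mapping.keys t. Poly_Mapping.lookup t x)"

definition homog :: "nat \<Rightarrow> ('x, 'k::field) mpoly set" where
  "homog d = {p. \<forall>t\<in>Poly_Mapping.keys p. mdeg t = d}"

definition generated_by_linear_forms :: "('x, 'k::field) mpoly set \<Rightarrow> bool" where
  "generated_by_linear_forms I \<longleftrightarrow> (\<exists>L \<subseteq> homog 1. I = module.span (*) L)"

text \<open>\<^term>\<open>N\<close> is the internal direct sum of the subsets \<^term>\<open>W j\<close>, \<^term>\<open>j \<in> J\<close>: every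
  element of \<^term>\<open>N\<close> is the sum of exactly one finitely supported family, and all
  these sums lie in \<^term>\<open>N\<close>.\<close>

definition is_direct_sum :: "'b::ab_group_add set \<Rightarrow> 'j set \<Rightarrow> ('j \<Rightarrow> 'b set) \<Rightarrow> bool" where
  "is_direct_sum N J W \<longleftrightarrow>
     bij_betw (\<lambda>w. \<Sum>j\<in>Poly_Mapping.keys w. Poly_Mapping.lookup w j)
       {w :: 'j \<Rightarrow>\<^sub>0 'b. Poly_Mapping.keys w \<subseteq> J \<and>
          (\<forall>j\<in>Poly_Mapping.keys w. Poly_Mapping.lookup w j \<in> W j)} N"

locale graded_module = module scale
  for scale :: "('x, 'k::field) mpoly \<Rightarrow> 'b::ab_group_add \<Rightarrow> 'b" +
  fixes deg_part :: "int \<Rightarrow> 'b set"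
  assumes zero_deg_part: "0 \<in> deg_part d"
    and diff_deg_part: "v \<in> deg_part d \<Longrightarrow> w \<in> deg_part d \<Longrightarrow> v - w \<in> deg_part d"
    and direct_sum_deg_part: "is_direct_sum UNIV UNIV deg_part"
    and scale_deg_part: "p \<in> homog d \<Longrightarrow> v \<in> deg_part e \<Longrightarrow> scale p v \<in> deg_part (int d + e)"

text \<open>Minimality is irredundancy of the indexed family, which in particular excludes repetitions.\<close>

definition minimal_homogeneous_generators ::
    "(('x, 'k::field) mpoly \<Rightarrow> 'b::ab_group_add \<Rightarrow> 'b) \<Rightarrow> (int \<Rightarrow> 'b set) \<Rightarrow> nat \<Rightarrow> (nat \<Rightarrow> 'b) \<Rightarrow> bool" where
  "minimal_homogeneous_generators scale deg_part m f \<longleftrightarrow>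
     (\<forall>i\<in>{1..m}. \<exists>d. f i \<in> deg_part d) \<and>
     module.span scale (f ` {1..m}) = UNIV \<and>
     (\<forall>A. A \<subset> {1..m} \<longrightarrow> module.span scale (f ` A) \<noteq> UNIV)"

definition colon :: "('s \<Rightarrow> 'b \<Rightarrow> 'b) \<Rightarrow> 'b set \<Rightarrow> 'b \<Rightarrow> 's set" where
  "colon scale N v = {h. scale h v \<in> N}"

definition linear_quotients_wrt ::
    "(('x, 'k::field) mpoly \<Rightarrow> 'b::ab_group_add \<Rightarrow> 'b) \<Rightarrow> nat \<Rightarrow> (nat \<Rightarrow> 'b) \<Rightarrow> bool" where
  "linear_quotients_wrt scale r g \<longleftrightarrow>
     (\<forall>j\<in>{1..r}. colon scale (module.span scale (g ` {1..<j})) (g j) = UNIV \<or>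
        generated_by_linear_forms (colon scale (module.span scale (g ` {1..<j})) (g j)))"

definition has_linear_quotients ::
    "(('x, 'k::field) mpoly \<Rightarrow> 'b::ab_group_add \<Rightarrow> 'b) \<Rightarrow> bool" where
  "has_linear_quotients scale \<longleftrightarrow>
     (\<exists>r g. module.span scale (g ` {1..r}) = UNIV \<and> linear_quotients_wrt scale r g)"

text \<open>The free module of rank \<^term>\<open>m\<close> is the submodule of vectors supported in
  \<^term>\<open>{1..m}\<close>; the type itself is free on all of \<^typ>\<open>nat\<close>.\<close>

type_synonym ('x, 'k) fvec = "nat \<Rightarrow>\<^sub>0 (('x \<Rightarrow>\<^sub>0 nat) \<Rightarrow>\<^sub>0 'k)"

definition fscale :: "('x, 'k::field) mpoly \<Rightarrow> ('x, 'k) fvec \<Rightarrow> ('x, 'k) fvec" where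
  "fscale p v = Poly_Mapping.map ((*) p) v"

definition free_mod :: "nat \<Rightarrow> ('x, 'k::field) fvec set" where
  "free_mod m = {v. Poly_Mapping.keys v \<subseteq> {1..m}}"

definition unit_vec :: "nat \<Rightarrow> ('x, 'k::field) fvec" where
  "unit_vec i = Poly_Mapping.single i 1"

lemma lookup_fscale: "Poly_Mapping.lookup (fscale p v) i = p * Poly_Mapping.lookup v i"
  by (simp add: fscale_def map.rep_eq when_def)

lemma module_fscale: "module fscale"
  by unfold_locales (auto intro!: poly_mapping_eqI simp: lookup_fscale lookup_add algebra_simps)

lemma module_mult: "module ((*) :: ('x, 'k::field) mpoly \<Rightarrow> _)"
  by unfold_locales (auto simp: algebra_simps)

definition monom_poly :: "'x monom \<Rightarrow> ('x, 'k::field) mpoly" where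
  "monom_poly u = Poly_Mapping.single u 1"

text \<open>Multiplication of monomials is addition of exponents, so \<^term>\<open>0\<close> is the monomial 1.\<close>

definition monomial_order :: "('x monom \<Rightarrow> 'x monom \<Rightarrow> bool) \<Rightarrow> bool" where
  "monomial_order lt \<longleftrightarrow> irreflp lt \<and> transp lt \<and> totalp lt \<and>
     (\<forall>u. u \<noteq> 0 \<longrightarrow> lt 0 u) \<and> (\<forall>u v w. lt u v \<longrightarrow> lt (u + w) (v + w))"

text \<open>The pair \<^term>\<open>(i, u)\<close> stands for the monomial \<^term>\<open>fscale (monom_poly u) (unit_vec i)\<close> of
  the free module.\<close>

definition vmono :: "nat \<times> 'x monom \<Rightarrow> ('x, 'k::field) fvec" where
  "vmono = (\<lambda>(i, u). fscale (monom_poly u) (unit_vec i))"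

definition vless :: "('x monom \<Rightarrow> 'x monom \<Rightarrow> bool) \<Rightarrow> nat \<times> 'x monom \<Rightarrow> nat \<times> 'x monom \<Rightarrow> bool" where
  "vless lt = (\<lambda>(i, u) (j, v). i < j \<or> i = j \<and> lt u v)"

definition vkeys :: "('x, 'k::field) fvec \<Rightarrow> (nat \<times> 'x monom) set" where
  "vkeys v = {(i, u). u \<in> Poly_Mapping.keys (Poly_Mapping.lookup v i)}"

definition greatest_wrt :: "('t \<Rightarrow> 't \<Rightarrow> bool) \<Rightarrow> 't set \<Rightarrow> 't" where
  "greatest_wrt lt A = (THE a. a \<in> A \<and> (\<forall>b\<in>A. b \<noteq> a \<longrightarrow> lt b a))"

definition initial_ideal ::
    "('x monom \<Rightarrow> 'x monom \<Rightarrow> bool) \<Rightarrow> ('x, 'k::field) mpoly set \<Rightarrow> ('x, 'k) mpoly set" where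
  "initial_ideal lt I =
     module.span (*) {monom_poly (greatest_wrt lt (Poly_Mapping.keys p)) | p. p \<in> I \<and> p \<noteq> 0}"

definition initial_module ::
    "('x monom \<Rightarrow> 'x monom \<Rightarrow> bool) \<Rightarrow> ('x, 'k::field) fvec set \<Rightarrow> ('x, 'k) fvec set" where
  "initial_module lt C =
     module.span fscale {vmono (greatest_wrt (vless lt) (vkeys v)) | v. v \<in> C \<and> v \<noteq> 0}"

definition minimal_monomial_generators ::
    "nat \<Rightarrow> ('x, 'k::field) fvec set \<Rightarrow> (nat \<times> 'x monom) set \<Rightarrow> bool" where
  "minimal_monomial_generators m N G \<longleftrightarrow>
     G \<subseteq> {1..m} \<times> UNIV \<and> module.span fscale (vmono ` G) = N \<and>
     (\<forall>H. H \<subset> G \<longrightarrow> module.span fscale (vmono ` H) \<noteq> N)"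

end

theory Submission
  imports Defs
begin

text \<open>
  A relation \<open>v\<close> whose last nonzero coordinate is the \<open>j\<close>-th says precisely that \<open>v\<^sub>j\<close> multiplies
  \<open>f\<^sub>j\<close> into the submodule generated by the earlier generators, that is \<open>v\<^sub>j \<in> I\<^sub>j\<close>, and every
  element of \<open>I\<^sub>j\<close> arises in this way. Since the order on \<open>F\<close> looks at the position first, the
  leading monomial of \<open>v\<close> is the leading monomial of \<open>v\<^sub>j\<close> times \<open>e\<^sub>j\<close>. So the leading monomials
  of \<open>C\<close> are the \<open>ue\<^sub>j\<close> with \<open>u\<close> a leading monomial of \<open>I\<^sub>j\<close> (\<open>lead_monoms_of_relations\<close>), and part
  (a) follows because the span of a set of monomials of \<open>F\<close> is determined coordinate by coordinate
  (\<open>monomial_submodule_iff\<close>).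

  For part (b), the leading monomials of \<open>C\<close> that are minimal for divisibility form a minimal generating
  set of its initial module (\<open>minimal_monomial_generators_exist\<close>). The hypothesis therefore says that each
  leading monomial of \<open>I\<^sub>j\<close> is divisible by a leading monomial of \<open>I\<^sub>j\<close> of degree at most 1. If 1
  occurs, then \<open>I\<^sub>j = S\<close>. Otherwise variables occur, and if \<open>I\<^sub>j\<close> is homogeneous, the linear
  components of the elements that they lead belong to \<open>I\<^sub>j\<close> and generate an ideal with the same leading
  monomials as \<open>I\<^sub>j\<close>. Two nested ideals with the same leading monomials agree, because a monomial
  order is well-founded (\<open>ideal_eqI_lead_monoms\<close>). Hence \<open>f\<^sub>1, \<dots>, f\<^sub>m\<close> itself has linear quotients.

  Homogeneity of \<open>I\<^sub>j\<close> takes an additional argument. The components of \<open>M\<close> are subgroups in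
  degrees \<open>d \<ge> 0\<close>, whereas the axioms let a component of negative degree be a subset that is not closed
  under addition. Components of an equation in \<open>M\<close> can thus be compared only after multiplication by a
  monomial of large degree. This shows that \<open>I\<^sub>j\<close> is almost homogeneous: the components of an element
  of \<open>I\<^sub>j\<close> lie in \<open>I\<^sub>j\<close> once multiplied by any monomial of large degree
  (\<open>almost_homogeneous_colon\<close>). An almost homogeneous proper ideal whose leading monomials are the
  multiples of certain variables is homogeneous (\<open>homogeneous_if_almost_homogeneous\<close>): the ideal of all
  polynomials without constant term that are multiplied into it by every monomial of large degree
  has no further leading monomials, so it is the same ideal.
\<close>

interpretation poly_ideal: module "(*) :: ('x, 'k::field) mpoly \<Rightarrow> _"
  by (rule module_mult)

interpretation free_module: module "fscale :: ('x, 'k::field) mpoly \<Rightarrow> _"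
  by (rule module_fscale)

section \<open>Monomials\<close>

lemma mdeg_eq_sum_UNIV: "mdeg (t :: 'x::finite monom) = (\<Sum>x\<in>UNIV. Poly_Mapping.lookup t x)"
  unfolding mdeg_def by (rule sum.mono_neutral_left) (auto simp: in_keys_iff)

lemma mdeg_add: "mdeg (s + t :: 'x::finite monom) = mdeg s + mdeg t"
  by (simp add: mdeg_eq_sum_UNIV lookup_add sum.distrib)

lemma mdeg_eq_0_iff: "mdeg (t :: 'x::finite monom) = 0 \<longleftrightarrow> t = 0"
  by (auto simp: mdeg_eq_sum_UNIV intro!: poly_mapping_eqI)

lemma monom_split:
  fixes u :: "'x monom"
  assumes "x \<in> Poly_Mapping.keys u"
  obtains s where "u = Poly_Mapping.single x 1 + s"
proof
  show "u = Poly_Mapping.single x 1 + (u - Poly_Mapping.single x 1)"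
    using assms by (intro poly_mapping_eqI)
      (auto simp: lookup_add lookup_minus lookup_single when_def in_keys_iff)
qed

lemma mdeg_single: "mdeg (Poly_Mapping.single x n) = n"
  by (simp add: mdeg_def)

lemma monom_of_degree_1:
  fixes u :: "'x::finite monom"
  assumes "mdeg u = 1"
  obtains x where "u = Poly_Mapping.single x 1"
proof -
  have "u \<noteq> 0"
    using assms mdeg_eq_0_iff[of u] by auto
  then obtain x where x: "x \<in> Poly_Mapping.keys u"
    by (metis ex_in_conv keys_eq_empty)
  then obtain s where s: "u = Poly_Mapping.single x 1 + s"
    by (rule monom_split)
  then have "s = 0"
    using assms mdeg_eq_0_iff[of s] by (simp add: mdeg_add mdeg_single)
  then show ?thesis
    using s that by simp
qed

lemma poly_mapping_eq_sum_single:
  "p = (\<Sum>t\<in>Poly_Mapping.keys p. Poly_Mapping.single t (Poly_Mapping.lookup p t))"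
  by (rule poly_mapping_eqI)
    (auto simp: lookup_sum lookup_single when_def in_keys_iff)

lemma lookup_single_mult_add:
  fixes p :: "('x, 'k::field) mpoly"
  shows "Poly_Mapping.lookup (Poly_Mapping.single u c * p) (u + s) = c * Poly_Mapping.lookup p s"
proof -
  have "Poly_Mapping.single u c * p =
      (\<Sum>t\<in>Poly_Mapping.keys p. Poly_Mapping.single (u + t) (c * Poly_Mapping.lookup p t))"
    by (subst poly_mapping_eq_sum_single[of p]) (simp add: sum_distrib_left mult_single)
  then show ?thesis
    by (auto simp: lookup_sum lookup_single when_def in_keys_iff)
qed

lemma keys_single_mult:
  fixes p :: "('x, 'k::field) mpoly"
  assumes "c \<noteq> 0"
  shows "Poly_Mapping.keys (Poly_Mapping.single u c * p) = (+) u ` Poly_Mapping.keys p"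
proof
  show "Poly_Mapping.keys (Poly_Mapping.single u c * p) \<subseteq> (+) u ` Poly_Mapping.keys p"
    using keys_mult[of "Poly_Mapping.single u c" p] assms by auto
  show "(+) u ` Poly_Mapping.keys p \<subseteq> Poly_Mapping.keys (Poly_Mapping.single u c * p)"
    using assms by (auto simp: in_keys_iff lookup_single_mult_add)
qed

definition homog_part :: "nat \<Rightarrow> ('x, 'k::field) mpoly \<Rightarrow> ('x, 'k) mpoly" where
  "homog_part d p = Poly_Mapping.mapp (\<lambda>t c. c when mdeg t = d) p"

lemma lookup_homog_part:
  "Poly_Mapping.lookup (homog_part d p) t = (Poly_Mapping.lookup p t when mdeg t = d)"
  by (simp add: homog_part_def lookup_mapp when_def in_keys_iff)

lemma keys_homog_part: "Poly_Mapping.keys (homog_part d p) = {t \<in> Poly_Mapping.keys p. mdeg t = d}"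
  by (auto simp: in_keys_iff lookup_homog_part)

lemma homog_part_in_homog: "homog_part d p \<in> homog d"
  by (simp add: homog_def keys_homog_part)

lemma homog_part_eq_0: "d \<notin> mdeg ` Poly_Mapping.keys p \<Longrightarrow> homog_part d p = 0"
  by (auto intro!: poly_mapping_eqI simp: lookup_homog_part when_def simp flip: not_in_keys_iff_lookup_eq_zero)

lemma sum_homog_parts: "(\<Sum>d\<in>mdeg ` Poly_Mapping.keys p. homog_part d p) = p"
proof (rule poly_mapping_eqI)
  fix t
  show "Poly_Mapping.lookup (\<Sum>d\<in>mdeg ` Poly_Mapping.keys p. homog_part d p) t = Poly_Mapping.lookup p t"
    by (auto simp: lookup_sum lookup_homog_part when_def in_keys_iff image_iff)
qed

section \<open>Leading monomials\<close>

lemma greatest_wrt_eqI: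
  assumes "irreflp lt" "transp lt" "a \<in> A" "\<And>b. b \<in> A \<Longrightarrow> b \<noteq> a \<Longrightarrow> lt b a"
  shows "greatest_wrt lt A = a"
  unfolding greatest_wrt_def
  by (rule the_equality) (use assms in \<open>auto dest: irreflpD transpD\<close>, metis irreflpD transpD)

lemma greatest_wrt_exists:
  assumes "transp lt" "totalp lt" "finite A" "A \<noteq> {}"
  shows "\<exists>a\<in>A. \<forall>b\<in>A. b \<noteq> a \<longrightarrow> lt b a"
  using assms(3,4)
proof (induction A rule: finite_ne_induct)
  case (insert x A)
  then obtain a where a: "a \<in> A" "\<And>b. b \<in> A \<Longrightarrow> b \<noteq> a \<Longrightarrow> lt b a"
    by blast
  then have "x \<noteq> a"
    using insert by blast
  then consider "lt x a" | "lt a x"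
    using assms(2) by (metis totalpD)
  then show ?case
  proof cases
    case 1
    then show ?thesis
      using a by auto
  next
    case 2
    then have "\<forall>b\<in>insert x A. b \<noteq> x \<longrightarrow> lt b x"
      using a assms(1) by (metis insertE transpD)
    then show ?thesis
      by blast
  qed
qed simp

definition lead_monom :: "('x monom \<Rightarrow> 'x monom \<Rightarrow> bool) \<Rightarrow> ('x, 'k::field) mpoly \<Rightarrow> 'x monom" where
  "lead_monom lt p = greatest_wrt lt (Poly_Mapping.keys p)"

definition lead_monoms ::
    "('x monom \<Rightarrow> 'x monom \<Rightarrow> bool) \<Rightarrow> ('x, 'k::field) mpoly set \<Rightarrow> 'x monom set" where
  "lead_monoms lt J = {lead_monom lt p | p. p \<in> J \<and> p \<noteq> 0}"

lemma lead_monomsI: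
  "p \<in> J \<Longrightarrow> p \<noteq> 0 \<Longrightarrow> lead_monom lt p = u \<Longrightarrow> u \<in> lead_monoms lt J"
  by (auto simp: lead_monoms_def)

lemma initial_ideal_eq: "initial_ideal lt J = poly_ideal.span (monom_poly ` lead_monoms lt J)"
  unfolding initial_ideal_def lead_monoms_def lead_monom_def
  by (rule arg_cong[of _ _ poly_ideal.span]) auto

lemma lead_monom_eqI:
  assumes "monomial_order lt" "u \<in> Poly_Mapping.keys p"
    "\<And>t. t \<in> Poly_Mapping.keys p \<Longrightarrow> t \<noteq> u \<Longrightarrow> lt t u"
  shows "lead_monom lt p = u"
  unfolding lead_monom_def using assms by (intro greatest_wrt_eqI) (auto simp: monomial_order_def)

lemma
  assumes "monomial_order lt" "p \<noteq> 0"
  shows lead_monom_in_keys: "lead_monom lt p \<in> Poly_Mapping.keys p"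
    and lt_lead_monom: "t \<in> Poly_Mapping.keys p \<Longrightarrow> t \<noteq> lead_monom lt p \<Longrightarrow> lt t (lead_monom lt p)"
proof -
  obtain u where "u \<in> Poly_Mapping.keys p" "\<And>t. t \<in> Poly_Mapping.keys p \<Longrightarrow> t \<noteq> u \<Longrightarrow> lt t u"
    using greatest_wrt_exists[of lt "Poly_Mapping.keys p"] assms
    by (auto simp: monomial_order_def)
  moreover from this have "lead_monom lt p = u"
    using lead_monom_eqI assms(1) by blast
  ultimately show "lead_monom lt p \<in> Poly_Mapping.keys p"
    "t \<in> Poly_Mapping.keys p \<Longrightarrow> t \<noteq> lead_monom lt p \<Longrightarrow> lt t (lead_monom lt p)"
    by auto
qed

section \<open>Spans of monomials\<close>

lemma monomial_ideal_keys:
  assumes "p \<in> poly_ideal.span (monom_poly ` A)" "t \<in> Poly_Mapping.keys p"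
  shows "\<exists>a\<in>A. \<exists>s. t = a + s"
  using assms
proof (induction p arbitrary: t rule: poly_ideal.span_induct_alt)
  case (step c x y)
  then obtain a where a: "a \<in> A" "x = Poly_Mapping.single a 1"
    by (auto simp: monom_poly_def)
  have "t \<in> Poly_Mapping.keys (x * c) \<or> t \<in> Poly_Mapping.keys y"
    using step.prems keys_add[of "c * x" y] by (auto simp: mult.commute)
  then show ?case
    using a step.IH by (auto simp: keys_single_mult)
qed simp

lemma fscale_unit_vec: "fscale p (unit_vec j) = Poly_Mapping.single j p"
  by (rule poly_mapping_eqI) (simp add: lookup_fscale unit_vec_def lookup_single when_def)

lemma vmono_eq_single: "vmono (j, u) = Poly_Mapping.single j (monom_poly u)"
  by (simp add: vmono_def fscale_unit_vec)

lemma fscale_single: "fscale p (Poly_Mapping.single j q) = Poly_Mapping.single j (p * q)"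
  by (rule poly_mapping_eqI) (simp add: lookup_fscale lookup_single when_def)

text \<open>Monomials of the free module at different positions do not interact, so the span of a set
  of monomials is a direct sum of monomial ideals, one for each position.\<close>

lemma monomial_submodule_iff:
  "v \<in> free_module.span (vmono ` A) \<longleftrightarrow>
     (\<forall>j. Poly_Mapping.lookup v j \<in> poly_ideal.span (monom_poly ` {u. (j, u) \<in> A}))"
  (is "_ \<longleftrightarrow> (\<forall>j. _ \<in> poly_ideal.span (?B j))")
proof
  assume "v \<in> free_module.span (vmono ` A)"
  then show "\<forall>j. Poly_Mapping.lookup v j \<in> poly_ideal.span (?B j)"
  proof (induction rule: free_module.span_induct_alt)
    case base
    then show ?case
      by (simp add: poly_ideal.span_zero)
  next
    case (step c x y)
    then obtain i u where iu: "(i, u) \<in> A" "x = vmono (i, u)"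
      by auto
    show ?case
    proof
      fix j
      have "Poly_Mapping.lookup x j \<in> poly_ideal.span (?B j)"
        using iu by (auto simp: vmono_eq_single lookup_single when_def
            intro: poly_ideal.span_zero poly_ideal.span_base)
      then show "Poly_Mapping.lookup (fscale c x + y) j \<in> poly_ideal.span (?B j)"
        using step.IH by (auto simp: lookup_add lookup_fscale
            intro: poly_ideal.span_add poly_ideal.span_scale)
    qed
  qed
next
  have single: "Poly_Mapping.single j p \<in> free_module.span (vmono ` A)"
    if "p \<in> poly_ideal.span (?B j)" for j p
    using that
  proof (induction rule: poly_ideal.span_induct_alt)
    case base
    then show ?case
      by (simp add: free_module.span_zero)
  next
    case (step c x y)
    then obtain u where u: "(j, u) \<in> A" "x = monom_poly u"
      by auto
    then have "Poly_Mapping.single j (c * x) = fscale c (vmono (j, u))"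
      by (simp add: vmono_eq_single fscale_single)
    also have "\<dots> \<in> free_module.span (vmono ` A)"
      using u by (intro free_module.span_scale free_module.span_base) auto
    finally show ?case
      using step.IH by (simp add: single_add free_module.span_add)
  qed
  assume "\<forall>j. Poly_Mapping.lookup v j \<in> poly_ideal.span (?B j)"
  then have "(\<Sum>j\<in>Poly_Mapping.keys v. Poly_Mapping.single j (Poly_Mapping.lookup v j))
      \<in> free_module.span (vmono ` A)"
    by (intro free_module.span_sum single) auto
  then show "v \<in> free_module.span (vmono ` A)"
    using poly_mapping_eq_sum_single[of v] by simp
qed

text \<open>The generating set consists of the elements of \<^term>\<open>A\<close> that no other element of \<^term>\<open>A\<close>
  properly divides. Every element of \<^term>\<open>A\<close> is a multiple of one of these, because the degree drops
  under proper division. None of them can be omitted, because a monomial in the span of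
  other monomials is a multiple of one of them.\<close>

lemma minimal_monomial_generators_exist:
  fixes A :: "(nat \<times> 'x::finite monom) set"
  assumes "A \<subseteq> {1..m} \<times> UNIV"
  obtains G where "G \<subseteq> A"
    "\<And>j u. (j, u) \<in> A \<Longrightarrow> \<exists>g s. (j, g) \<in> G \<and> u = g + s"
    "minimal_monomial_generators m
       (free_module.span (vmono ` A) :: ('x, 'k::field) fvec set) G"
proof
  let ?N = "free_module.span (vmono ` A) :: ('x, 'k) fvec set"
  define G where "G = {(j, u). (j, u) \<in> A \<and> (\<forall>g s. (j, g) \<in> A \<longrightarrow> u = g + s \<longrightarrow> s = 0)}"
  show GA: "G \<subseteq> A"
    by (auto simp: G_def)
  show div: "\<exists>g s. (j, g) \<in> G \<and> u = g + s" if "(j, u) \<in> A" for j u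
    using that
  proof (induction "mdeg u" arbitrary: u rule: less_induct)
    case less
    show ?case
    proof (cases "(j, u) \<in> G")
      case True
      then show ?thesis
        by (metis add.right_neutral)
    next
      case False
      then obtain g s where gs: "(j, g) \<in> A" "u = g + s" "s \<noteq> 0"
        using less.prems by (auto simp: G_def)
      then have "mdeg g < mdeg u"
        using mdeg_eq_0_iff[of s] by (simp add: mdeg_add)
      then obtain g' s' where "(j, g') \<in> G" "g = g' + s'"
        using less.hyps gs(1) by blast
      then show ?thesis
        using gs(2) by (metis add.assoc)
    qed
  qed
  have "vmono ` A \<subseteq> (free_module.span (vmono ` G) :: ('x, 'k) fvec set)"
  proof clarify
    fix j u assume "(j, u) \<in> A"
    then obtain g s where g: "(j, g) \<in> G" "u = g + s"
      using div by blast
    then have "vmono (j, u) = fscale (monom_poly s) (vmono (j, g) :: ('x, 'k) fvec)"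
      by (simp add: vmono_eq_single fscale_single monom_poly_def mult_single add.commute)
    then show "vmono (j, u) \<in> (free_module.span (vmono ` G) :: ('x, 'k) fvec set)"
      using g(1) by (simp add: free_module.span_scale free_module.span_base)
  qed
  then have span: "(free_module.span (vmono ` G) :: ('x, 'k) fvec set) = ?N"
    using GA by (intro subset_antisym free_module.span_mono image_mono
        free_module.span_minimal free_module.subspace_span)
  have "free_module.span (vmono ` H) \<noteq> ?N" if H: "H \<subset> G" for H
  proof
    assume eq: "free_module.span (vmono ` H) = ?N"
    obtain j u where ju: "(j, u) \<in> G" "(j, u) \<notin> H"
      using H by auto
    have "vmono (j, u) \<in> (free_module.span (vmono ` H) :: ('x, 'k) fvec set)"
      unfolding eq using ju(1) GA by (intro free_module.span_base imageI) auto
    then have "(monom_poly u :: ('x, 'k) mpoly) \<in> poly_ideal.span (monom_poly ` {u. (j, u) \<in> H})"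
      unfolding monomial_submodule_iff vmono_eq_single by (metis lookup_single_eq)
    moreover have "u \<in> Poly_Mapping.keys (monom_poly u :: ('x, 'k) mpoly)"
      by (simp add: monom_poly_def)
    ultimately obtain g s where g: "(j, g) \<in> H" "u = g + s"
      by (blast dest: monomial_ideal_keys)
    moreover have "(j, g) \<in> A"
      using g(1) H GA by blast
    ultimately have "s = 0"
      using ju(1) unfolding G_def by blast
    then show False
      using g ju(2) by simp
  qed
  then show "minimal_monomial_generators m ?N G"
    using assms GA span by (auto simp: minimal_monomial_generators_def)
qed

section \<open>Monomial orders are well-founded\<close>

lemma nat_seq_incseq_subseq:
  fixes a :: "nat \<Rightarrow> nat"
  obtains r where "strict_mono r" "incseq (\<lambda>n. a (r n))"
proof -
  obtain f where f: "strict_mono f" "monoseq (\<lambda>n. a (f n))"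
    using seq_monosub by blast
  then consider "incseq (\<lambda>n. a (f n))" | "decseq (\<lambda>n. a (f n))"
    by (auto simp: monoseq_iff)
  then show ?thesis
  proof cases
    case 1
    then show ?thesis
      using that f(1) by blast
  next
    case 2
    obtain N where N: "\<And>n. a (f N) \<le> a (f n)"
      using ex_has_least_nat[of "\<lambda>_. True" 0 "\<lambda>n. a (f n)"] by auto
    have const: "a (f (N + n)) = a (f N)" for n
      using N decseqD[OF 2, of N "N + n"] by (simp add: le_antisym)
    have "strict_mono (\<lambda>n. f (N + n))"
      using f(1) by (simp add: strict_mono_def)
    then show ?thesis
      using that const by (simp add: incseq_def)
  qed
qed

text \<open>A form of Dickson's lemma: a subsequence that is weakly increasing in one variable after
  another is extracted.\<close>

lemma monom_seq_incseq_subseq: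
  fixes s :: "nat \<Rightarrow> 'x monom"
  assumes "finite X"
  shows "\<exists>r. strict_mono r \<and> (\<forall>x\<in>X. incseq (\<lambda>n. Poly_Mapping.lookup (s (r n)) x))"
  using assms
proof (induction X rule: finite_induct)
  case empty
  show ?case
    using strict_mono_id by auto
next
  case (insert x X)
  then obtain r where r: "strict_mono r" "\<forall>x\<in>X. incseq (\<lambda>n. Poly_Mapping.lookup (s (r n)) x)"
    by blast
  obtain r' where r': "strict_mono r'" "incseq (\<lambda>n. Poly_Mapping.lookup (s (r (r' n))) x)"
    by (rule nat_seq_incseq_subseq)
  have "incseq (\<lambda>n. Poly_Mapping.lookup (s (r (r' n))) y)" if "y \<in> X" for y
    using r(2) that strict_mono_mono[OF r'(1)] by (auto simp: incseq_def mono_def)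
  moreover have "strict_mono (\<lambda>n. r (r' n))"
    using r(1) r'(1) by (simp add: strict_mono_def)
  ultimately show ?case
    using r'(2) by (intro exI[of _ "\<lambda>n. r (r' n)"]) auto
qed

text \<open>In an infinite descending sequence, Dickson's lemma provides a term that divides a later
  one. A monomial order puts divisors first, so this contradicts the descent.\<close>

lemma wfp_monomial_order:
  fixes lt :: "'x::finite monom \<Rightarrow> 'x monom \<Rightarrow> bool"
  assumes ord: "monomial_order lt"
  shows "wfp lt"
proof (rule ccontr)
  assume "\<not> wfp lt"
  then obtain s where s: "\<And>n. lt (s (Suc n)) (s n)"
    unfolding wfp_def wf_iff_no_infinite_down_chain by auto
  have desc: "lt (s j) (s i)" if "i < j" for i j
    using that
  proof (induction j)
    case (Suc j)
    then show ?case
      using s[of j] ord by (auto simp: monomial_order_def less_Suc_eq dest: transpD)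
  qed simp
  obtain r where r: "strict_mono r" "\<And>x. incseq (\<lambda>n. Poly_Mapping.lookup (s (r n)) x)"
    using monom_seq_incseq_subseq[of UNIV s] by auto
  let ?i = "r 0" and ?j = "r 1"
  have le: "Poly_Mapping.lookup (s ?i) x \<le> Poly_Mapping.lookup (s ?j) x" for x
    using r(2)[of x] by (simp add: incseq_def)
  have eq: "s ?j = (s ?j - s ?i) + s ?i"
    using le by (intro poly_mapping_eqI) (simp add: lookup_add lookup_minus)
  have gt: "lt (s ?j) (s ?i)"
    using desc r(1) by (simp add: strict_mono_def)
  then have "s ?j - s ?i \<noteq> 0"
    using eq ord by (metis add_0 irreflpD monomial_order_def)
  then have "lt (0 + s ?i) ((s ?j - s ?i) + s ?i)"
    using ord unfolding monomial_order_def by blast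
  then have "lt (s ?i) (s ?j)"
    using eq by simp
  then show False
    using gt ord unfolding monomial_order_def by (blast dest: transpD irreflpD)
qed

section \<open>Comparing ideals by leading monomials\<close>

lemma lead_monom_single_mult:
  fixes p :: "('x, 'k::field) mpoly"
  assumes ord: "monomial_order lt" and "p \<noteq> 0" and "c \<noteq> 0"
  shows "lead_monom lt (Poly_Mapping.single s c * p) = s + lead_monom lt p"
proof (rule lead_monom_eqI[OF ord])
  show "s + lead_monom lt p \<in> Poly_Mapping.keys (Poly_Mapping.single s c * p)"
    using lead_monom_in_keys[OF ord assms(2)] by (simp add: keys_single_mult[OF assms(3)])
  fix t assume t: "t \<in> Poly_Mapping.keys (Poly_Mapping.single s c * p)" "t \<noteq> s + lead_monom lt p"
  then obtain r where r: "t = s + r" "r \<in> Poly_Mapping.keys p"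
    by (auto simp: keys_single_mult[OF assms(3)])
  then have "lt (r + s) (lead_monom lt p + s)"
    using lt_lead_monom[OF ord assms(2)] t(2) ord by (auto simp: monomial_order_def)
  then show "lt t (s + lead_monom lt p)"
    by (simp add: r add.commute)
qed

lemma lead_monoms_mult:
  fixes J :: "('x, 'k::field) mpoly set"
  assumes ord: "monomial_order lt" and ideal: "poly_ideal.subspace J" and "u \<in> lead_monoms lt J"
  shows "s + u \<in> lead_monoms lt J"
proof -
  obtain p where p: "p \<in> J" "p \<noteq> 0" "u = lead_monom lt p"
    using assms(3) by (auto simp: lead_monoms_def)
  let ?q = "Poly_Mapping.single s 1 * p"
  have "Poly_Mapping.keys ?q \<noteq> {}"
    using p(2) by (simp add: keys_single_mult)
  then have "?q \<noteq> 0"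
    by auto
  moreover have "?q \<in> J"
    using ideal p(1) by (rule poly_ideal.subspace_scale)
  moreover have "lead_monom lt ?q = s + u"
    using lead_monom_single_mult[OF ord p(2), of 1] p(3) by simp
  ultimately show ?thesis
    by (blast intro: lead_monomsI)
qed

text \<open>An element of the larger ideal shares its leading monomial with an element of the smaller
  one. Subtracting a multiple of the latter cancels the leading term and leaves an element of the
  larger ideal with a smaller leading monomial, to which well-founded induction applies.\<close>

lemma ideal_eqI_lead_monoms:
  fixes J J' :: "('x::finite, 'k::field) mpoly set"
  assumes ord: "monomial_order lt"
    and ideals: "poly_ideal.subspace J" "poly_ideal.subspace J'"
    and "J \<subseteq> J'" and lead: "lead_monoms lt J' \<subseteq> lead_monoms lt J"
  shows "J' = J"
proof -
  have "p \<in> J" if "p \<in> J'" for p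
    using that
  proof (induction "lead_monom lt p" arbitrary: p rule: wfp_induct_rule[OF wfp_monomial_order[OF ord]])
    case (1 p)
    show ?case
    proof (cases "p = 0")
      case True
      then show ?thesis
        using poly_ideal.subspace_0[OF ideals(1)] by simp
    next
      case False
      define u where "u = lead_monom lt p"
      have "u \<in> lead_monoms lt J'"
        using False 1(2) by (auto simp: u_def lead_monoms_def)
      then obtain q where q: "q \<in> J" "q \<noteq> 0" "lead_monom lt q = u"
        using lead by (auto simp: lead_monoms_def)
      define c where "c = Poly_Mapping.lookup p u / Poly_Mapping.lookup q u"
      define h where "h = Poly_Mapping.single 0 c * q"
      have hJ: "h \<in> J"
        unfolding h_def using ideals(1) q(1) by (rule poly_ideal.subspace_scale)
      have lookup_h: "Poly_Mapping.lookup h t = c * Poly_Mapping.lookup q t" for t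
        using lookup_single_mult_add[of 0 c q t] by (simp add: h_def)
      have "u \<in> Poly_Mapping.keys q"
        using lead_monom_in_keys[OF ord q(2)] q(3) by simp
      \<comment> \<open>\<^term>\<open>c\<close> is chosen so that the leading terms cancel.\<close>
      then have "Poly_Mapping.lookup (p - h) u = 0"
        by (simp add: lookup_minus lookup_h c_def in_keys_iff)
      then have "t \<noteq> u" if "t \<in> Poly_Mapping.keys (p - h)" for t
        using that by (auto simp: in_keys_iff)
      moreover have "t \<in> Poly_Mapping.keys p \<or> t \<in> Poly_Mapping.keys q"
        if "t \<in> Poly_Mapping.keys (p - h)" for t
        using that by (auto simp: in_keys_iff lookup_minus lookup_h)
      ultimately have smaller: "lt t u" if "t \<in> Poly_Mapping.keys (p - h)" for t
        using that lt_lead_monom[OF ord False, of t] lt_lead_monom[OF ord q(2), of t] q(3) u_def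
        by metis
      have "p - h \<in> J"
      proof (cases "p - h = 0")
        case True
        then show ?thesis
          using poly_ideal.subspace_0[OF ideals(1)] by simp
      next
        case False
        then have "lt (lead_monom lt (p - h)) u"
          using smaller lead_monom_in_keys[OF ord False] by blast
        moreover have "p - h \<in> J'"
          using poly_ideal.subspace_diff[OF ideals(2) 1(2)] hJ assms(4) by blast
        ultimately show ?thesis
          using 1(1) u_def by blast
      qed
      then show ?thesis
        using poly_ideal.subspace_add[OF ideals(1) _ hJ] by fastforce
    qed
  qed
  then show ?thesis
    using assms(4) by blast
qed

section \<open>Ideals whose initial ideal is generated in degree at most one\<close>

text \<open>An element led by a variable has a linear component led by the same variable, whatever the order
  does with its terms of other degrees. So the linear forms in \<^term>\<open>J\<close> account for all the leading
  monomials of \<^term>\<open>J\<close>, and they generate \<^term>\<open>J\<close>.\<close>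

lemma linear_generation_of_homogeneous_ideal:
  fixes J :: "('x::finite, 'k::field) mpoly set"
  assumes ord: "monomial_order lt"
    and ideal: "poly_ideal.subspace J"
    and graded: "\<And>p d. p \<in> J \<Longrightarrow> homog_part d p \<in> J"
    and divisor: "\<And>u. u \<in> lead_monoms lt J \<Longrightarrow>
      \<exists>g s. g \<in> lead_monoms lt J \<and> u = g + s \<and> mdeg g = 1"
  shows "generated_by_linear_forms J"
proof -
  let ?L = "poly_ideal.span (J \<inter> homog 1)"
  have "lead_monoms lt J \<subseteq> lead_monoms lt ?L"
  proof
    fix u assume "u \<in> lead_monoms lt J"
    then obtain p s where p: "p \<in> J" "p \<noteq> 0" "u = lead_monom lt p + s" "mdeg (lead_monom lt p) = 1"
      using divisor by (fastforce simp: lead_monoms_def)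
    then have in_part: "lead_monom lt p \<in> Poly_Mapping.keys (homog_part 1 p)"
      using lead_monom_in_keys[OF ord p(2)] by (simp add: keys_homog_part)
    have "lead_monom lt (homog_part 1 p) = lead_monom lt p"
      by (rule lead_monom_eqI[OF ord in_part])
        (auto simp: keys_homog_part intro: lt_lead_monom[OF ord p(2)])
    moreover have "homog_part 1 p \<noteq> 0"
      using in_part by auto
    moreover have "homog_part 1 p \<in> ?L"
      using graded[OF p(1)] homog_part_in_homog by (intro poly_ideal.span_base) auto
    ultimately have "lead_monom lt p \<in> lead_monoms lt ?L"
      by (blast intro: lead_monomsI)
    then show "u \<in> lead_monoms lt ?L"
      using lead_monoms_mult[OF ord poly_ideal.subspace_span] p(3) by (metis add.commute)
  qed
  moreover have "?L \<subseteq> J"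
    using ideal by (intro poly_ideal.span_minimal) auto
  ultimately have "J = ?L"
    using ideal_eqI_lead_monoms[OF ord poly_ideal.subspace_span ideal] by blast
  then show ?thesis
    unfolding generated_by_linear_forms_def by blast
qed

lemma ideal_eq_UNIV_if_lead_monom_0:
  fixes J :: "('x, 'k::field) mpoly set"
  assumes ord: "monomial_order lt" and ideal: "poly_ideal.subspace J" and "0 \<in> lead_monoms lt J"
  shows "J = UNIV"
proof -
  obtain p where p: "p \<in> J" "p \<noteq> 0" "lead_monom lt p = 0"
    using assms(3) unfolding lead_monoms_def by auto
  \<comment> \<open>The monomial 1 is the least one, so it can only lead a constant.\<close>
  have "t = 0" if "t \<in> Poly_Mapping.keys p" for t
  proof (rule ccontr)
    assume "t \<noteq> 0"
    then have "lt t 0" "lt 0 t"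
      using lt_lead_monom[OF ord p(2) that] p(3) ord by (auto simp: monomial_order_def)
    then show False
      using ord by (auto simp: monomial_order_def dest: transpD irreflpD)
  qed
  then have keys: "Poly_Mapping.keys p = {0}"
    using p(2) by (metis keys_eq_empty subsetI singletonI subset_singletonD)
  define c where "c = Poly_Mapping.lookup p 0"
  have pc: "p = Poly_Mapping.single 0 c"
    using poly_mapping_eq_sum_single[of p] keys by (simp add: c_def)
  have "c \<noteq> 0"
    using p(2) pc by auto
  then have "Poly_Mapping.single 0 (1 / c) * p = 1"
    unfolding pc by (simp add: mult_single)
  then have "1 \<in> J"
    using poly_ideal.subspace_scale[OF ideal p(1)] by metis
  then have "q \<in> J" for q
    using poly_ideal.subspace_scale[OF ideal, of 1 q] by simp
  then show ?thesis
    by blast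
qed

lemma lead_monom_monom_poly: "lead_monom lt (monom_poly u :: ('x, 'k::field) mpoly) = u"
  unfolding lead_monom_def greatest_wrt_def monom_poly_def by (rule the_equality) auto

text \<open>A homogeneous ideal satisfies this with \<open>k = 0\<close>. The ideal generated by \<open>x - 1\<close>
  does not satisfy it, although its initial ideal is generated by the variable \<open>x\<close>.\<close>

definition almost_homogeneous :: "('x, 'k::field) mpoly set \<Rightarrow> bool" where
  "almost_homogeneous J \<longleftrightarrow>
     (\<exists>k. \<forall>p\<in>J. \<forall>d t. k \<le> mdeg t \<longrightarrow> monom_poly t * homog_part d p \<in> J)"

text \<open>If some element \<open>p\<close> had a nonzero constant term, then all monomials of large degree
  would lie in \<^term>\<open>J\<close>. Since 1 does not, there is a monomial \<open>u\<close> of largest degree outside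
  \<^term>\<open>J\<close>, which leads to a contradiction: all terms of \<open>u p\<close> but the constant term
  times \<open>u\<close> have larger degree and lie in \<^term>\<open>J\<close>, hence so does \<open>u\<close>.\<close>

lemma const_coeff_eq_0_if_proper_almost_homogeneous:
  fixes J :: "('x::finite, 'k::field) mpoly set"
  assumes ideal: "poly_ideal.subspace J" and "almost_homogeneous J" and "1 \<notin> J" and p: "p \<in> J"
  shows "Poly_Mapping.lookup p 0 = 0"
proof (rule ccontr)
  define c where "c = Poly_Mapping.lookup p 0"
  assume "Poly_Mapping.lookup p 0 \<noteq> 0"
  then have c: "c \<noteq> 0"
    by (simp add: c_def)
  have cancel: "monom_poly t \<in> J" if "Poly_Mapping.single t c \<in> J" for t
    using poly_ideal.subspace_scale[OF ideal that, of "Poly_Mapping.single 0 (1 / c)"] c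
    by (simp add: mult_single monom_poly_def)
  obtain k where k: "\<And>t. k \<le> mdeg t \<Longrightarrow> monom_poly t * homog_part 0 p \<in> J"
    using assms(2) p unfolding almost_homogeneous_def by blast
  have "homog_part 0 p = Poly_Mapping.single 0 c"
    by (rule poly_mapping_eqI)
      (auto simp: lookup_homog_part lookup_single when_def c_def mdeg_eq_0_iff)
  then have large: "monom_poly t \<in> J" if "k \<le> mdeg t" for t
    using k[OF that] cancel[of t] by (simp add: monom_poly_def mult_single)
  have "(monom_poly 0 :: ('x, 'k) mpoly) \<notin> J"
    using assms(3) by (simp add: monom_poly_def)
  then obtain u where u: "monom_poly u \<notin> J"
    and max: "\<And>t. monom_poly t \<notin> J \<Longrightarrow> mdeg t \<le> mdeg u"
    using large ex_has_greatest_nat[of "\<lambda>t. monom_poly t \<notin> J" 0 mdeg k]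
    by (metis linorder_not_le nat_less_le)
  have "Poly_Mapping.single (u + t) b \<in> J" if "t \<noteq> 0" for t b
  proof -
    have "mdeg u < mdeg (u + t)"
      using that mdeg_eq_0_iff[of t] by (simp add: mdeg_add)
    then have "monom_poly (u + t) \<in> J"
      using max[of "u + t"] by fastforce
    then show ?thesis
      using poly_ideal.subspace_scale[OF ideal, of "monom_poly (u + t)" "Poly_Mapping.single 0 b"]
      by (simp add: monom_poly_def mult_single)
  qed
  then have rest: "(\<Sum>t\<in>Poly_Mapping.keys p - {0}. Poly_Mapping.single (u + t) (Poly_Mapping.lookup p t)) \<in> J"
    by (intro poly_ideal.subspace_sum[OF ideal]) auto
  have "monom_poly u * p =
      (\<Sum>t\<in>Poly_Mapping.keys p. Poly_Mapping.single (u + t) (Poly_Mapping.lookup p t))"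
    by (subst poly_mapping_eq_sum_single[of p]) (simp add: sum_distrib_left mult_single monom_poly_def)
  also have "\<dots> = Poly_Mapping.single u c +
      (\<Sum>t\<in>Poly_Mapping.keys p - {0}. Poly_Mapping.single (u + t) (Poly_Mapping.lookup p t))"
    using c by (subst sum.remove[of _ 0]) (auto simp: c_def in_keys_iff)
  finally have "monom_poly u * p - (\<Sum>t\<in>Poly_Mapping.keys p - {0}. Poly_Mapping.single (u + t) (Poly_Mapping.lookup p t))
      = Poly_Mapping.single u c"
    by simp
  then have "Poly_Mapping.single u c \<in> J"
    using poly_ideal.subspace_diff[OF ideal poly_ideal.subspace_scale[OF ideal p, of "monom_poly u"] rest]
    by simp
  then show False
    using cancel u by blast
qed

text \<open>The components of the elements of \<^term>\<open>J\<close> lie in the ideal \<open>J'\<close> of the polynomials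
  without constant term that every monomial of large degree multiplies into \<^term>\<open>J\<close>, so
  \<open>J' = J\<close> is what has to be shown. Let \<open>u\<close> be a leading monomial of \<open>J'\<close>. If every variable is a
  leading monomial of \<^term>\<open>J\<close>, so is \<open>u \<noteq> 1\<close>. Otherwise let \<open>z\<close> be a variable that is not. For large
  \<open>k\<close>, the monomial \<open>z\<^sup>k u\<close> leads an element of \<^term>\<open>J\<close>, so it is divisible by a leading variable
  of \<^term>\<open>J\<close>. This variable is not \<open>z\<close> and therefore divides \<open>u\<close>.\<close>

lemma homogeneous_if_almost_homogeneous:
  fixes J :: "('x::finite, 'k::field) mpoly set"
  assumes ord: "monomial_order lt"
    and ideal: "poly_ideal.subspace J"
    and almost: "almost_homogeneous J"
    and proper: "1 \<notin> J"
    and divisor: "\<And>u. u \<in> lead_monoms lt J \<Longrightarrow>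
      \<exists>g s. g \<in> lead_monoms lt J \<and> u = g + s \<and> mdeg g = 1"
    and "p \<in> J"
  shows "homog_part d p \<in> J"
proof -
  define J' where "J' = {q. 0 \<notin> Poly_Mapping.keys q \<and> (\<exists>k. \<forall>t. k \<le> mdeg t \<longrightarrow> monom_poly t * q \<in> J)}"
  have const: "0 \<notin> Poly_Mapping.keys q" if "q \<in> J" for q
    using const_coeff_eq_0_if_proper_almost_homogeneous[OF ideal almost proper that]
    by (simp add: in_keys_iff)
  have "poly_ideal.subspace J'"
  proof (rule poly_ideal.subspaceI)
    show "0 \<in> J'"
      using poly_ideal.subspace_0[OF ideal] by (simp add: J'_def)
    show "q + r \<in> J'" if qr: "q \<in> J'" "r \<in> J'" for q r
    proof -
      obtain k l where "\<And>t. k \<le> mdeg t \<Longrightarrow> monom_poly t * q \<in> J" "\<And>t. l \<le> mdeg t \<Longrightarrow> monom_poly t * r \<in> J"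
        using qr unfolding J'_def by blast
      then have "monom_poly t * (q + r) \<in> J" if "max k l \<le> mdeg t" for t
        using that poly_ideal.subspace_add[OF ideal] by (simp add: distrib_left)
      then show ?thesis
        using qr keys_add[of q r] unfolding J'_def by blast
    qed
    show "c * q \<in> J'" if q: "q \<in> J'" for c q
    proof -
      obtain k where "\<And>t. k \<le> mdeg t \<Longrightarrow> monom_poly t * q \<in> J"
        using q unfolding J'_def by blast
      then have "monom_poly t * (c * q) \<in> J" if "k \<le> mdeg t" for t
        using that poly_ideal.subspace_scale[OF ideal, of "monom_poly t * q" c]
        unfolding mult.left_commute[of "monom_poly t" c q] by blast
      moreover have "0 \<notin> Poly_Mapping.keys (c * q)"
      proof
        assume "0 \<in> Poly_Mapping.keys (c * q)"
        then obtain a b where ab: "0 = a + b" "b \<in> Poly_Mapping.keys q"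
          using keys_mult[of c q] by blast
        then have "mdeg b = 0"
          using mdeg_add[of a b] mdeg_eq_0_iff[of "a + b"] by simp
        then show False
          using ab(2) q by (simp add: mdeg_eq_0_iff J'_def)
      qed
      ultimately show ?thesis
        unfolding J'_def by blast
    qed
  qed
  moreover have "J \<subseteq> J'"
    using const poly_ideal.subspace_scale[OF ideal] by (auto simp: J'_def)
  moreover have "lead_monoms lt J' \<subseteq> lead_monoms lt J"
  proof
    fix u assume "u \<in> lead_monoms lt J'"
    then obtain q where q: "q \<in> J'" "q \<noteq> 0" "u = lead_monom lt q"
      by (auto simp: lead_monoms_def)
    then have "u \<noteq> 0"
      using lead_monom_in_keys[OF ord q(2)] unfolding J'_def by auto
    have "\<exists>x\<in>Poly_Mapping.keys u. Poly_Mapping.single x 1 \<in> lead_monoms lt J"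
    proof (cases "\<forall>x. Poly_Mapping.single x 1 \<in> lead_monoms lt J")
      case True
      then show ?thesis
        using \<open>u \<noteq> 0\<close> by (metis ex_in_conv keys_eq_empty)
    next
      case False
      then obtain z where z: "Poly_Mapping.single z 1 \<notin> lead_monoms lt J"
        by blast
      obtain k where k: "\<And>t. k \<le> mdeg t \<Longrightarrow> monom_poly t * q \<in> J"
        using q(1) unfolding J'_def by blast
      let ?t = "Poly_Mapping.single z k"
      have "monom_poly ?t * q \<in> J"
        by (rule k) (simp add: mdeg_single)
      moreover have "Poly_Mapping.keys (monom_poly ?t * q) \<noteq> {}"
        using q(2) by (simp add: monom_poly_def keys_single_mult)
      moreover have "lead_monom lt (monom_poly ?t * q) = ?t + u"
        using lead_monom_single_mult[OF ord q(2), of 1 ?t] q(3) by (simp add: monom_poly_def)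
      ultimately have "?t + u \<in> lead_monoms lt J"
        by (intro lead_monomsI[of "monom_poly ?t * q"]) auto
      then obtain g s where g: "g \<in> lead_monoms lt J" "?t + u = g + s" "mdeg g = 1"
        using divisor by blast
      then obtain x where x: "g = Poly_Mapping.single x 1"
        using monom_of_degree_1 by blast
      have "x \<noteq> z"
        using x z g(1) by auto
      moreover have "Poly_Mapping.lookup (?t + u) x = Poly_Mapping.lookup (g + s) x"
        using g(2) by simp
      ultimately have "x \<in> Poly_Mapping.keys u"
        by (simp add: x lookup_add lookup_single in_keys_iff)
      then show ?thesis
        using g(1) x by blast
    qed
    then obtain x where x: "x \<in> Poly_Mapping.keys u" "Poly_Mapping.single x 1 \<in> lead_monoms lt J"
      by blast
    obtain s where "u = Poly_Mapping.single x 1 + s"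
      using x(1) by (rule monom_split)
    then show "u \<in> lead_monoms lt J"
      using lead_monoms_mult[OF ord ideal x(2), of s] by (simp add: add.commute)
  qed
  ultimately have "J' = J"
    by (intro ideal_eqI_lead_monoms[OF ord ideal])
  moreover have "homog_part d p \<in> J'"
    using almost assms(6) const[OF assms(6)] unfolding J'_def almost_homogeneous_def
    by (auto simp: keys_homog_part)
  ultimately show ?thesis
    by simp
qed

lemma linear_generation_of_almost_homogeneous_ideal:
  fixes J :: "('x::finite, 'k::field) mpoly set"
  assumes ord: "monomial_order lt"
    and ideal: "poly_ideal.subspace J"
    and almost: "almost_homogeneous J"
    and divisor: "\<And>u. u \<in> lead_monoms lt J \<Longrightarrow>
      \<exists>g s. g \<in> lead_monoms lt J \<and> u = g + s \<and> mdeg g \<le> 1"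
  shows "J = UNIV \<or> generated_by_linear_forms J"
proof (cases "0 \<in> lead_monoms lt J")
  case True
  then show ?thesis
    using ideal_eq_UNIV_if_lead_monom_0[OF ord ideal] by blast
next
  case False
  have proper: "1 \<notin> J"
  proof
    assume "1 \<in> J"
    then have "lead_monom lt (1 :: ('x, 'k) mpoly) \<in> lead_monoms lt J"
      by (intro lead_monomsI) auto
    then show False
      using False lead_monom_monom_poly[of lt 0, where 'k = 'k] by (simp add: monom_poly_def)
  qed
  have linear: "\<exists>g s. g \<in> lead_monoms lt J \<and> u = g + s \<and> mdeg g = 1"
    if u: "u \<in> lead_monoms lt J" for u
  proof -
    obtain g s where g: "g \<in> lead_monoms lt J" "u = g + s" "mdeg g \<le> 1"
      using divisor[OF u] by blast
    then have "mdeg g \<noteq> 0"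
      using False mdeg_eq_0_iff[of g] by auto
    then show ?thesis
      using g by (metis le_antisym less_one linorder_not_less)
  qed
  show ?thesis
    using linear_generation_of_homogeneous_ideal[OF ord ideal _ linear]
      homogeneous_if_almost_homogeneous[OF ord ideal almost proper linear] by blast
qed

section \<open>Colon ideals in a graded module\<close>

lemma (in module) subspace_colon:
  assumes "subspace N"
  shows "module.subspace (*) (colon scale N v)"
proof -
  interpret ideal: module "(*) :: 'a \<Rightarrow> _"
    by unfold_locales (auto simp: algebra_simps)
  show ?thesis
    using assms by (auto simp: colon_def ideal.subspace_def subspace_def scale_left_distrib
        simp flip: scale_scale)
qed

context graded_module
begin

lemma add_deg_part_nonneg:
  "v \<in> deg_part (int d) \<Longrightarrow> w \<in> deg_part (int d) \<Longrightarrow> v + w \<in> deg_part (int d)"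
  using diff_deg_part[of v d "0 - w"] diff_deg_part[of 0 d w] zero_deg_part by simp

text \<open>Decompositions are restricted to nonnegative degrees, where the components are closed under
  addition.\<close>

definition decomposes :: "'b \<Rightarrow> (nat \<Rightarrow>\<^sub>0 'b) \<Rightarrow> bool" where
  "decomposes v w \<longleftrightarrow> (\<forall>n. Poly_Mapping.lookup w n \<in> deg_part (int n)) \<and>
     v = (\<Sum>n\<in>Poly_Mapping.keys w. Poly_Mapping.lookup w n)"

text \<open>Uniqueness is that of the direct sum over all integer degrees, to which the families
  indexed by natural numbers are extended by zero.\<close>

lemma decomposes_unique:
  assumes "decomposes v w" "decomposes v w'"
  shows "w = w'"
proof -
  define shift :: "(nat \<Rightarrow>\<^sub>0 'b) \<Rightarrow> int \<Rightarrow>\<^sub>0 'b" where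
    "shift w = (\<Sum>n\<in>Poly_Mapping.keys w. Poly_Mapping.single (int n) (Poly_Mapping.lookup w n))" for w
  have lookup: "Poly_Mapping.lookup (shift w) (int n) = Poly_Mapping.lookup w n" for w n
    by (auto simp: shift_def lookup_sum lookup_single when_def in_keys_iff)
  have lookup_neg: "Poly_Mapping.lookup (shift w) i = 0" if "i < 0" for w i
    using that by (auto simp: shift_def lookup_sum lookup_single when_def intro!: sum.neutral)
  have keys: "Poly_Mapping.keys (shift w) = int ` Poly_Mapping.keys w" for w
  proof (intro set_eqI iffI)
    fix i assume i: "i \<in> Poly_Mapping.keys (shift w)"
    then have "i = int (nat i)"
      using lookup_neg[of i w] by (cases "i < 0") (auto simp: in_keys_iff)
    then show "i \<in> int ` Poly_Mapping.keys w"
      using i lookup[of w "nat i"] by (metis image_eqI in_keys_iff)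
  qed (auto simp: in_keys_iff lookup)
  have sum: "(\<Sum>d\<in>Poly_Mapping.keys (shift w). Poly_Mapping.lookup (shift w) d) = v"
    and homog: "\<forall>d\<in>Poly_Mapping.keys (shift w). Poly_Mapping.lookup (shift w) d \<in> deg_part d"
    if "decomposes v w" for w
    using that by (auto simp: decomposes_def keys lookup sum.reindex)
  have "inj_on (\<lambda>w. \<Sum>d\<in>Poly_Mapping.keys w. Poly_Mapping.lookup w d)
      {w. Poly_Mapping.keys w \<subseteq> UNIV \<and> (\<forall>d\<in>Poly_Mapping.keys w. Poly_Mapping.lookup w d \<in> deg_part d)}"
    using direct_sum_deg_part unfolding is_direct_sum_def by (rule bij_betw_imp_inj_on)
  then have eq: "shift w = shift w'"
    by (rule inj_onD) (simp_all add: sum homog assms)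
  have "Poly_Mapping.lookup w n = Poly_Mapping.lookup w' n" for n
    using lookup[of w n] lookup[of w' n] eq by simp
  then show ?thesis
    by (rule poly_mapping_eqI)
qed

lemma decomposes_0: "decomposes 0 0"
  by (simp add: decomposes_def zero_deg_part)

lemma decomposes_add:
  assumes "decomposes v w" "decomposes v' w'"
  shows "decomposes (v + v') (w + w')"
  using assms setsum_keys_plus_distrib[of "\<lambda>_ x. x" w w']
  by (auto simp: decomposes_def lookup_add add_deg_part_nonneg)

lemma decomposes_scale:
  assumes "v \<in> deg_part (int c)"
  obtains w where "decomposes (scale p v) w"
    and "\<And>n. Poly_Mapping.lookup w n = (scale (homog_part (n - c) p) v when c \<le> n)"
proof -
  define w where "w = (\<Sum>d\<in>mdeg ` Poly_Mapping.keys p. Poly_Mapping.single (d + c) (scale (homog_part d p) v))"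
  have single: "decomposes u (Poly_Mapping.single n u)" if "u \<in> deg_part (int n)" for n u
    using that zero_deg_part by (auto simp: decomposes_def lookup_single when_def)
  have "decomposes (\<Sum>d\<in>D. scale (homog_part d p) v)
      (\<Sum>d\<in>D. Poly_Mapping.single (d + c) (scale (homog_part d p) v))" if "finite D" for D
    using that
  proof (induction D rule: finite_induct)
    case empty
    show ?case
      by (simp add: decomposes_0)
  next
    case (insert d D)
    then show ?case
      using decomposes_add single scale_deg_part[OF homog_part_in_homog assms] by simp
  qed
  then have "decomposes (\<Sum>d\<in>mdeg ` Poly_Mapping.keys p. scale (homog_part d p) v) w"
    by (simp add: w_def)
  then have "decomposes (scale p v) w"
    by (simp add: sum_homog_parts flip: scale_sum_left)
  moreover have "Poly_Mapping.lookup w n = (scale (homog_part (n - c) p) v when c \<le> n)" for n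
  proof -
    have "Poly_Mapping.lookup w n = (\<Sum>d\<in>mdeg ` Poly_Mapping.keys p.
        if d = n - c \<and> c \<le> n then scale (homog_part (n - c) p) v else 0)"
      unfolding w_def lookup_sum by (rule sum.cong) (auto simp: lookup_single when_def)
    also have "\<dots> = (scale (homog_part (n - c) p) v when c \<le> n)"
      by (cases "c \<le> n") (auto simp: homog_part_eq_0)
    finally show ?thesis .
  qed
  ultimately show ?thesis
    using that by blast
qed

lemma decomposes_in_span:
  assumes "\<And>b. b \<in> B \<Longrightarrow> \<exists>n. b \<in> deg_part (int n)" and "v \<in> span B"
  shows "\<exists>w. decomposes v w \<and> (\<forall>n. Poly_Mapping.lookup w n \<in> span B)"
  using assms(2)
proof (induction rule: span_induct_alt)
  case base
  then show ?case
    using decomposes_0 span_zero by (metis lookup_zero)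
next
  case (step p x y)
  obtain c where "x \<in> deg_part (int c)"
    using assms(1) step.hyps by blast
  then obtain w where w: "decomposes (scale p x) w"
    "\<And>n. Poly_Mapping.lookup w n = (scale (homog_part (n - c) p) x when c \<le> n)"
    by (metis decomposes_scale)
  have in_span: "Poly_Mapping.lookup w n \<in> span B" for n
    using step.hyps by (auto simp: w(2) when_def intro: span_scale span_base span_zero)
  obtain w' where w': "decomposes y w'" "\<And>n. Poly_Mapping.lookup w' n \<in> span B"
    using step.IH by blast
  have "decomposes (scale p x + y) (w + w')"
    using w(1) w'(1) by (rule decomposes_add)
  moreover have "Poly_Mapping.lookup (w + w') n \<in> span B" for n
    using in_span w'(2) by (simp add: lookup_add span_add)
  ultimately show ?case
    by blast
qed

text \<open>The multiples of \<^term>\<open>v\<close> by the components of \<^term>\<open>p\<close> are the components of \<^term>\<open>scale p v\<close>,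
  and an element of a submodule generated by homogeneous elements has its components there.\<close>

lemma homog_part_scale_in_span:
  assumes "\<And>b. b \<in> B \<Longrightarrow> \<exists>n. b \<in> deg_part (int n)" and "v \<in> deg_part (int c)"
    and "scale p v \<in> span B"
  shows "scale (homog_part d p) v \<in> span B"
proof -
  obtain w where w: "decomposes (scale p v) w"
    "\<And>n. Poly_Mapping.lookup w n = (scale (homog_part (n - c) p) v when c \<le> n)"
    using assms(2) by (metis decomposes_scale)
  obtain w' where w': "decomposes (scale p v) w'" "\<And>n. Poly_Mapping.lookup w' n \<in> span B"
    using decomposes_in_span[OF assms(1,3)] by blast
  have "Poly_Mapping.lookup w (d + c) \<in> span B"
    using decomposes_unique[OF w(1) w'(1)] w'(2) by simp
  then show ?thesis
    by (simp add: w(2))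
qed

text \<open>A monomial of large degree moves \<^term>\<open>v\<close> and the finitely many elements of \<^term>\<open>B\<close> into
  nonnegative degrees, where homogeneous components can be compared.\<close>

lemma almost_homogeneous_colon:
  assumes "finite B" and homog_B: "\<And>b. b \<in> B \<Longrightarrow> \<exists>e. b \<in> deg_part e" and "v \<in> deg_part c"
  shows "almost_homogeneous (colon scale (span B) v)"
proof -
  obtain e where e: "\<And>b. b \<in> B \<Longrightarrow> b \<in> deg_part (e b)"
    using homog_B by metis
  \<comment> \<open>A bound on how far the degrees of \<^term>\<open>v\<close> and of the elements of \<^term>\<open>B\<close> lie below zero.\<close>
  define k where "k = nat \<bar>c\<bar> + (\<Sum>b\<in>B. nat \<bar>e b\<bar>)"
  have "nat \<bar>e b\<bar> \<le> k" if "b \<in> B" for b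
    using member_le_sum[of b B "\<lambda>b. nat \<bar>e b\<bar>"] that assms(1) by (simp add: k_def)
  then have k_e: "0 \<le> int k + e b" if "b \<in> B" for b
    using that by fastforce
  have "nat \<bar>c\<bar> \<le> k"
    by (simp add: k_def)
  then have k_c: "0 \<le> int k + c"
    by linarith
  have nonneg: "\<exists>n. scale (monom_poly t) x \<in> deg_part (int n)"
    if "x \<in> deg_part i" "0 \<le> int k + i" "k \<le> mdeg t" for x i t
  proof -
    have "monom_poly t \<in> homog (mdeg t)"
      by (simp add: homog_def monom_poly_def)
    then have "scale (monom_poly t) x \<in> deg_part (int (mdeg t) + i)"
      using that(1) by (rule scale_deg_part)
    moreover have "int (mdeg t) + i = int (nat (int (mdeg t) + i))"
      using that(2,3) by simp
    ultimately show ?thesis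
      by metis
  qed
  have "monom_poly t * homog_part d p \<in> colon scale (span B) v"
    if p: "p \<in> colon scale (span B) v" and t: "k \<le> mdeg t" for p d t
  proof -
    \<comment> \<open>The submodule generated by the multiples \<open>t b\<close> contains \<open>t p v\<close>, lies in
      \<^term>\<open>span B\<close>, and is generated in nonnegative degrees.\<close>
    let ?tB = "scale (monom_poly t) ` B"
    have times_t: "scale (monom_poly t) x \<in> span ?tB" if "x \<in> span B" for x
      using that
    proof (induction rule: span_induct_alt)
      case base
      then show ?case
        by (simp add: span_zero)
    next
      case (step q x y)
      have "scale q (scale (monom_poly t) x) \<in> span ?tB"
        using step.hyps by (intro span_scale span_base) auto
      then show ?case
        using step.IH by (simp add: scale_right_distrib span_add mult.commute)
    qed
    have "?tB \<subseteq> span B"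
      by (auto intro: span_scale span_base)
    then have tB: "span ?tB \<subseteq> span B"
      by (intro span_minimal subspace_span)
    have "scale (monom_poly t) (scale p v) \<in> span ?tB"
      using p unfolding colon_def mem_Collect_eq by (rule times_t)
    then have in_span: "scale p (scale (monom_poly t) v) \<in> span ?tB"
      by (metis scale_left_commute)
    obtain n where "scale (monom_poly t) v \<in> deg_part (int n)"
      using nonneg[OF assms(3) k_c t] by blast
    moreover have "\<exists>n. b \<in> deg_part (int n)" if "b \<in> ?tB" for b
      using that nonneg[OF e k_e t] by blast
    ultimately have "scale (homog_part d p) (scale (monom_poly t) v) \<in> span ?tB"
      using in_span by (intro homog_part_scale_in_span) auto
    then show ?thesis
      using tB by (auto simp: colon_def mult.commute)
  qed
  then show ?thesis
    unfolding almost_homogeneous_def by blast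
qed

end

section \<open>Leading monomials of the relation module\<close>

lemma greatest_wrt_vkeys:
  fixes v :: "('x, 'k::field) fvec"
  assumes ord: "monomial_order lt" and j: "j \<in> Poly_Mapping.keys v" "Poly_Mapping.keys v \<subseteq> {..j}"
  shows "greatest_wrt (vless lt) (vkeys v) = (j, lead_monom lt (Poly_Mapping.lookup v j))"
proof (rule greatest_wrt_eqI)
  have nz: "Poly_Mapping.lookup v j \<noteq> 0"
    using j(1) by (simp add: in_keys_iff)
  show "irreflp (vless lt)" "transp (vless lt)"
    using ord unfolding monomial_order_def irreflp_def transp_def vless_def by (auto, blast?)
  show "(j, lead_monom lt (Poly_Mapping.lookup v j)) \<in> vkeys v"
    using lead_monom_in_keys[OF ord nz] by (simp add: vkeys_def)
  fix b assume b: "b \<in> vkeys v" "b \<noteq> (j, lead_monom lt (Poly_Mapping.lookup v j))"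
  obtain i u where iu: "b = (i, u)"
    by force
  have u: "u \<in> Poly_Mapping.keys (Poly_Mapping.lookup v i)"
    using b(1) by (simp add: iu vkeys_def)
  then have "i \<in> Poly_Mapping.keys v"
    by (auto simp: in_keys_iff[of i])
  then have "i \<le> j"
    using j(2) by auto
  then show "vless lt b (j, lead_monom lt (Poly_Mapping.lookup v j))"
    using b(2) u lt_lead_monom[OF ord nz] by (auto simp: iu vless_def le_less)
qed

text \<open>The map \<^term>\<open>\<phi>\<close> is constrained only on the free module of rank \<^term>\<open>m\<close>, which is a proper subset
  of its type.\<close>

locale relations = module scale
  for scale :: "('x::finite, 'k::field) mpoly \<Rightarrow> 'b::ab_group_add \<Rightarrow> 'b" +
  fixes m :: nat and f :: "nat \<Rightarrow> 'b" and \<phi> :: "('x, 'k) fvec \<Rightarrow> 'b"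
  assumes map_add: "v \<in> free_mod m \<Longrightarrow> w \<in> free_mod m \<Longrightarrow> \<phi> (v + w) = \<phi> v + \<phi> w"
    and map_fscale: "v \<in> free_mod m \<Longrightarrow> \<phi> (fscale p v) = scale p (\<phi> v)"
    and map_unit_vec: "i \<in> {1..m} \<Longrightarrow> \<phi> (unit_vec i) = f i"
begin

lemma free_mod_add: "v \<in> free_mod m \<Longrightarrow> w \<in> free_mod m \<Longrightarrow> v + w \<in> free_mod m"
  using keys_add[of v w] by (auto simp: free_mod_def)

lemma single_in_free_mod: "i \<in> {1..m} \<Longrightarrow> Poly_Mapping.single i p \<in> free_mod m"
  by (auto simp: free_mod_def)

lemma map_single:
  assumes "i \<in> {1..m}"
  shows "\<phi> (Poly_Mapping.single i p) = scale p (f i)"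
  using map_fscale[OF single_in_free_mod, of i p 1] assms map_unit_vec[OF assms]
  by (simp add: unit_vec_def fscale_single)

lemma map_zero: "\<phi> 0 = 0"
  using map_add[of 0 0] by (simp add: free_mod_def)

lemma map_eq_sum:
  assumes "v \<in> free_mod m"
  shows "\<phi> v = (\<Sum>i\<in>Poly_Mapping.keys v. scale (Poly_Mapping.lookup v i) (f i))"
proof -
  let ?v = "\<lambda>A. \<Sum>i\<in>A. Poly_Mapping.single i (Poly_Mapping.lookup v i)"
  have "?v A \<in> free_mod m \<and> \<phi> (?v A) = (\<Sum>i\<in>A. scale (Poly_Mapping.lookup v i) (f i))"
    if "finite A" "A \<subseteq> {1..m}" for A
    using that
  proof (induction A rule: finite_induct)
    case empty
    then show ?case
      by (simp add: map_zero free_mod_def)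
  next
    case (insert i A)
    then show ?case
      by (simp add: map_add map_single free_mod_add single_in_free_mod)
  qed
  from this[of "Poly_Mapping.keys v"] show ?thesis
    using assms by (simp add: free_mod_def flip: poly_mapping_eq_sum_single)
qed

lemma span_eq_map_image:
  assumes "A \<subseteq> {1..m}"
  shows "span (f ` A) = \<phi> ` {v. Poly_Mapping.keys v \<subseteq> A}"
proof
  have A: "v \<in> free_mod m" if "Poly_Mapping.keys v \<subseteq> A" for v :: "('x, 'k) fvec"
    using that assms by (auto simp: free_mod_def)
  show "\<phi> ` {v. Poly_Mapping.keys v \<subseteq> A} \<subseteq> span (f ` A)"
    by (auto simp: map_eq_sum[OF A] intro!: span_sum intro: span_scale span_base)
  show "span (f ` A) \<subseteq> \<phi> ` {v. Poly_Mapping.keys v \<subseteq> A}"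
  proof
    fix y assume "y \<in> span (f ` A)"
    then show "y \<in> \<phi> ` {v. Poly_Mapping.keys v \<subseteq> A}"
    proof (induction rule: span_induct_alt)
      case base
      then show ?case
        by (intro image_eqI[of _ _ 0]) (simp_all add: map_zero)
    next
      case (step p x y)
      obtain i v where i: "i \<in> A" "x = f i" and v: "y = \<phi> v" "Poly_Mapping.keys v \<subseteq> A"
        using step by auto
      have "Poly_Mapping.keys (Poly_Mapping.single i p + v) \<subseteq> A"
        using keys_add[of "Poly_Mapping.single i p" v] i v by (auto split: if_splits)
      moreover have "\<phi> (Poly_Mapping.single i p + v) = scale p x + y"
        using i v assms A[OF v(2)] by (subst map_add) (auto simp: map_single single_in_free_mod)
      ultimately show ?case
        by (intro image_eqI[of _ _ "Poly_Mapping.single i p + v"]) auto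
    qed
  qed
qed

abbreviation generator_colon :: "nat \<Rightarrow> ('x, 'k) mpoly set" where
  "generator_colon j \<equiv> colon scale (span (f ` {1..<j})) (f j)"

text \<open>From left to right, a relation with last nonzero coordinate \<open>p\<close> at position \<open>j\<close> is solved for
  \<^term>\<open>scale p (f j)\<close>. From right to left, an expression of \<^term>\<open>scale p (f j)\<close> in the earlier generators is
  written as a relation.\<close>

lemma lead_monoms_of_relations:
  assumes ord: "monomial_order lt"
  shows "{greatest_wrt (vless lt) (vkeys v) | v. v \<in> free_mod m \<and> \<phi> v = 0 \<and> v \<noteq> 0} =
    {(j, u). j \<in> {1..m} \<and> u \<in> lead_monoms lt (generator_colon j)}"
    (is "?L = ?R")
proof
  show "?L \<subseteq> ?R"
  proof clarify
    fix j u v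
    assume ju: "(j, u) = greatest_wrt (vless lt) (vkeys v)"
      and v: "v \<in> free_mod m" "\<phi> v = 0" "v \<noteq> 0"
    define j' where "j' = Max (Poly_Mapping.keys v)"
    have j': "j' \<in> Poly_Mapping.keys v" "Poly_Mapping.keys v \<subseteq> {..j'}"
      using v(3) by (auto simp: j'_def)
    then have "(j, u) = (j', lead_monom lt (Poly_Mapping.lookup v j'))"
      unfolding ju by (rule greatest_wrt_vkeys[OF ord])
    then have j: "j \<in> Poly_Mapping.keys v" "Poly_Mapping.keys v \<subseteq> {..j}"
      and u: "lead_monom lt (Poly_Mapping.lookup v j) = u"
      using j' by auto
    let ?p = "Poly_Mapping.lookup v j"
    let ?S = "\<Sum>i\<in>Poly_Mapping.keys v - {j}. scale (Poly_Mapping.lookup v i) (f i)"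
    have "scale ?p (f j) + ?S = 0"
      using map_eq_sum[OF v(1)] v(2) j(1) by (simp add: sum.remove[of _ j])
    then have "scale ?p (f j) = - ?S"
      by (simp add: eq_neg_iff_add_eq_0)
    also have "\<dots> \<in> span (f ` {1..<j})"
    proof (intro span_neg span_sum span_scale span_base imageI)
      fix i assume "i \<in> Poly_Mapping.keys v - {j}"
      then have "i \<in> {1..m}" "i \<le> j" "i \<noteq> j"
        using v(1) j(2) by (auto simp: free_mod_def)
      then show "i \<in> {1..<j}"
        by simp
    qed
    finally have "?p \<in> generator_colon j"
      by (simp add: colon_def)
    moreover have "?p \<noteq> 0"
      using j(1) by (simp add: in_keys_iff)
    ultimately show "j \<in> {1..m} \<and> u \<in> lead_monoms lt (generator_colon j)"
      using u v(1) j(1) by (auto simp: free_mod_def intro: lead_monomsI)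
  qed
  show "?R \<subseteq> ?L"
  proof clarify
    fix j u assume j: "j \<in> {1..m}" and "u \<in> lead_monoms lt (generator_colon j)"
    then obtain p where p: "scale p (f j) \<in> span (f ` {1..<j})" "p \<noteq> 0" "u = lead_monom lt p"
      by (auto simp: lead_monoms_def colon_def)
    have "{1..<j} \<subseteq> {1..m}"
      using j by auto
    with p(1) obtain w where w: "scale p (f j) = \<phi> w" "Poly_Mapping.keys w \<subseteq> {1..<j}"
      using span_eq_map_image by auto
    define v where "v = Poly_Mapping.single j p - w"
    have "Poly_Mapping.keys v \<subseteq> insert j (Poly_Mapping.keys w)"
      using keys_diff[of "Poly_Mapping.single j p" w] p(2) by (simp add: v_def)
    also have "\<dots> \<subseteq> {1..j}"
      using w(2) j by auto
    finally have keys: "Poly_Mapping.keys v \<subseteq> {1..j}" .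
    have "w \<in> free_mod m" "v \<in> free_mod m"
      using w(2) keys j by (fastforce simp: free_mod_def)+
    then have "\<phi> v + \<phi> w = \<phi> (v + w)"
      using map_add by simp
    also have "\<dots> = \<phi> w"
      using j w(1) by (simp add: v_def map_single)
    finally have "\<phi> v = 0"
      by simp
    moreover have "Poly_Mapping.lookup w j = 0"
      using w(2) by (auto simp: in_keys_iff)
    then have lookup: "Poly_Mapping.lookup v j = p"
      by (simp add: v_def lookup_minus)
    then have jv: "j \<in> Poly_Mapping.keys v"
      using p(2) by (simp add: in_keys_iff)
    have "Poly_Mapping.keys v \<subseteq> {..j}"
      using keys by auto
    then have "greatest_wrt (vless lt) (vkeys v) = (j, u)"
      using greatest_wrt_vkeys[OF ord jv] lookup p(3) by simp
    moreover have "v \<noteq> 0"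
      using jv by auto
    ultimately show "\<exists>v. (j, u) = greatest_wrt (vless lt) (vkeys v) \<and> v \<in> free_mod m \<and> \<phi> v = 0 \<and> v \<noteq> 0"
      using \<open>v \<in> free_mod m\<close> by metis
  qed
qed

lemma initial_module_of_relations:
  assumes "monomial_order lt"
  shows "initial_module lt {v \<in> free_mod m. \<phi> v = 0} =
    free_module.span (vmono ` {(j, u). j \<in> {1..m} \<and> u \<in> lead_monoms lt (generator_colon j)})"
proof -
  have "{vmono (greatest_wrt (vless lt) (vkeys v)) :: ('x, 'k) fvec |v. v \<in> {v \<in> free_mod m. \<phi> v = 0} \<and> v \<noteq> 0} =
      vmono ` {greatest_wrt (vless lt) (vkeys v) | v. v \<in> free_mod m \<and> \<phi> v = 0 \<and> v \<noteq> 0}"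
    by blast
  then show ?thesis
    unfolding initial_module_def lead_monoms_of_relations[OF assms] by simp
qed

lemma initial_module_of_relations_iff:
  assumes "monomial_order lt"
  shows "v \<in> initial_module lt {v \<in> free_mod m. \<phi> v = 0} \<longleftrightarrow>
    Poly_Mapping.keys v \<subseteq> {1..m} \<and>
    (\<forall>j\<in>{1..m}. Poly_Mapping.lookup v j \<in> initial_ideal lt (generator_colon j))"
proof -
  let ?A = "\<lambda>j. {u. (j, u) \<in> {(j, u). j \<in> {1..m} \<and> u \<in> lead_monoms lt (generator_colon j)}}"
  have "Poly_Mapping.lookup v j \<in> poly_ideal.span (monom_poly ` ?A j) \<longleftrightarrow>
      (if j \<in> {1..m} then Poly_Mapping.lookup v j \<in> initial_ideal lt (generator_colon j)
       else j \<notin> Poly_Mapping.keys v)" for j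
  proof (cases "j \<in> {1..m}")
    case False
    then have "?A j = {}"
      by auto
    then show ?thesis
      using False by (simp only: image_empty poly_ideal.span_empty) (auto simp: in_keys_iff)
  qed (simp add: initial_ideal_eq)
  then show ?thesis
    unfolding initial_module_of_relations[OF assms] monomial_submodule_iff by (auto split: if_splits)
qed

end

section \<open>Direct sums along the basis of the free module\<close>

text \<open>The only candidate for the family with sum \<open>v\<close> has the member \<open>v\<^sub>j e\<^sub>j\<close> at position \<open>j\<close>. The
  condition on \<open>0\<close> is needed because a family may skip positions.\<close>

lemma is_direct_sum_coordinates:
  fixes N :: "('x, 'k::field) fvec set"
  assumes "\<And>v. v \<in> N \<longleftrightarrow> Poly_Mapping.keys v \<subseteq> J \<and> (\<forall>j\<in>J. Poly_Mapping.lookup v j \<in> W j)"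
    and "\<And>j. j \<in> J \<Longrightarrow> 0 \<in> W j"
  shows "is_direct_sum N J (\<lambda>j. {fscale p (unit_vec j) | p. p \<in> W j})"
proof -
  let ?\<sigma> = "\<lambda>w :: nat \<Rightarrow>\<^sub>0 ('x, 'k) fvec. \<Sum>j\<in>Poly_Mapping.keys w. Poly_Mapping.lookup w j"
  let ?F = "{w. Poly_Mapping.keys w \<subseteq> J \<and>
    (\<forall>j\<in>Poly_Mapping.keys w. Poly_Mapping.lookup w j \<in> {fscale p (unit_vec j) | p. p \<in> W j})}"
  have family: "Poly_Mapping.lookup w j = Poly_Mapping.single j (Poly_Mapping.lookup (?\<sigma> w) j) \<and>
      (j \<in> J \<longrightarrow> Poly_Mapping.lookup (?\<sigma> w) j \<in> W j) \<and> (j \<notin> J \<longrightarrow> Poly_Mapping.lookup (?\<sigma> w) j = 0)"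
    if w: "w \<in> ?F" for w j
  proof -
    have coord: "\<exists>p. Poly_Mapping.lookup w i = Poly_Mapping.single i p \<and> (i \<in> J \<longrightarrow> p \<in> W i) \<and> (i \<notin> J \<longrightarrow> p = 0)" for i
    proof (cases "i \<in> Poly_Mapping.keys w")
      case True
      then show ?thesis
        using w by (auto simp: fscale_unit_vec)
    next
      case False
      then show ?thesis
        using assms(2)[of i] by (intro exI[of _ 0]) (simp add: in_keys_iff)
    qed
    then obtain p where p: "\<And>i. Poly_Mapping.lookup w i = Poly_Mapping.single i (p i)"
        "\<And>i. i \<in> J \<Longrightarrow> p i \<in> W i" "\<And>i. i \<notin> J \<Longrightarrow> p i = 0"
      by metis
    have "Poly_Mapping.lookup (?\<sigma> w) j = (\<Sum>i\<in>Poly_Mapping.keys w. p i when i = j)"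
      by (simp add: lookup_sum p(1) lookup_single)
    also have "\<dots> = p j"
    proof (cases "j \<in> Poly_Mapping.keys w")
      case False
      then have "p j = 0"
        using p(1)[of j] by (metis in_keys_iff lookup_single_eq lookup_zero)
      then show ?thesis
        using False by (auto simp: when_def)
    qed (simp add: when_def)
    finally show ?thesis
      using p by auto
  qed
  have "bij_betw ?\<sigma> ?F N"
  proof (rule bij_betw_imageI)
    show "inj_on ?\<sigma> ?F"
    proof (rule inj_onI)
      fix w w' assume w: "w \<in> ?F" "w' \<in> ?F" and eq: "?\<sigma> w = ?\<sigma> w'"
      show "w = w'"
      proof (rule poly_mapping_eqI)
        fix j
        have "Poly_Mapping.lookup w j = Poly_Mapping.single j (Poly_Mapping.lookup (?\<sigma> w) j)"
          using family[OF w(1)] by blast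
        also have "\<dots> = Poly_Mapping.lookup w' j"
          unfolding eq using family[OF w(2), of j] by simp
        finally show "Poly_Mapping.lookup w j = Poly_Mapping.lookup w' j" .
      qed
    qed
    show "?\<sigma> ` ?F = N"
    proof
      show "?\<sigma> ` ?F \<subseteq> N"
      proof (rule image_subsetI)
        fix w assume "w \<in> ?F"
        note fam = family[OF this]
        have "Poly_Mapping.keys (?\<sigma> w) \<subseteq> J"
        proof
          fix j assume "j \<in> Poly_Mapping.keys (?\<sigma> w)"
          then show "j \<in> J"
            using fam[of j] by (auto simp: in_keys_iff)
        qed
        then show "?\<sigma> w \<in> N"
          unfolding assms(1) using fam by blast
      qed
      show "N \<subseteq> ?\<sigma> ` ?F"
      proof
        fix v assume v: "v \<in> N"
        let ?w = "Poly_Mapping.mapp Poly_Mapping.single v :: nat \<Rightarrow>\<^sub>0 ('x, 'k) fvec"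
        have lookup: "Poly_Mapping.lookup ?w j = Poly_Mapping.single j (Poly_Mapping.lookup v j)" for j
          by (simp add: lookup_mapp in_keys_iff when_def)
        have "Poly_Mapping.keys v \<subseteq> Poly_Mapping.keys ?w"
        proof
          fix j assume "j \<in> Poly_Mapping.keys v"
          then have "Poly_Mapping.lookup (Poly_Mapping.lookup ?w j) j \<noteq> 0"
            unfolding lookup by (simp add: in_keys_iff)
          then show "j \<in> Poly_Mapping.keys ?w"
            by (auto simp: in_keys_iff)
        qed
        then have keys: "Poly_Mapping.keys ?w = Poly_Mapping.keys v"
          by (intro subset_antisym keys_mapp_subset)
        have "?\<sigma> ?w = v"
          unfolding keys lookup by (rule poly_mapping_eq_sum_single[symmetric])
        moreover have "?w \<in> ?F"
          using v unfolding assms(1) keys mem_Collect_eq lookup fscale_unit_vec by auto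
        ultimately show "v \<in> ?\<sigma> ` ?F"
          by (intro image_eqI[of v ?\<sigma> ?w]) (rule sym)
      qed
    qed
  qed
  then show ?thesis
    unfolding is_direct_sum_def .
qed

theorem proposition1p3:
  fixes scale :: "('x::finite, 'k::field) mpoly \<Rightarrow> 'b::ab_group_add \<Rightarrow> 'b"
    and deg_part :: "int \<Rightarrow> 'b set"
    and m :: nat
    and f :: "nat \<Rightarrow> 'b"
    and \<phi> :: "('x, 'k) fvec \<Rightarrow> 'b"
    and C :: "('x, 'k) fvec set"
    and lt :: "'x monom \<Rightarrow> 'x monom \<Rightarrow> bool"
    and I :: "nat \<Rightarrow> ('x, 'k) mpoly set"
  assumes "graded_module scale deg_part"
    and "minimal_homogeneous_generators scale deg_part m f"
    and "\<And>v w. v \<in> free_mod m \<Longrightarrow> w \<in> free_mod m \<Longrightarrow> \<phi> (v + w) = \<phi> v + \<phi> w"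
    and "\<And>p v. v \<in> free_mod m \<Longrightarrow> \<phi> (fscale p v) = scale p (\<phi> v)"
    and "\<And>i. i \<in> {1..m} \<Longrightarrow> \<phi> (unit_vec i) = f i"
    and "C = {v \<in> free_mod m. \<phi> v = 0}"
    and "monomial_order lt"
    and "\<And>j. j \<in> {1..m} \<Longrightarrow> I j = colon scale (module.span scale (f ` {1..<j})) (f j)"
  shows "is_direct_sum (initial_module lt C) {1..m}
           (\<lambda>j. {fscale p (unit_vec j) | p. p \<in> initial_ideal lt (I j)}) \<and>
         ((\<forall>G. minimal_monomial_generators m (initial_module lt C) G \<longrightarrow>
             (\<forall>(i, u)\<in>G. mdeg u \<le> 1)) \<longrightarrow>
          has_linear_quotients scale)"
proof -
  interpret graded_module scale deg_part
    by fact
  interpret relations scale m f \<phi>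
    by unfold_locales (use assms in auto)
  let ?A = "{(j, u). j \<in> {1..m} \<and> u \<in> lead_monoms lt (I j)}"
  have "?A = {(j, u). j \<in> {1..m} \<and> u \<in> lead_monoms lt (generator_colon j)}"
    using assms(8) by auto
  then have in_C: "initial_module lt C = free_module.span (vmono ` ?A)"
    using initial_module_of_relations[OF assms(7)] assms(6) by simp
  have "is_direct_sum (initial_module lt C) {1..m}
      (\<lambda>j. {fscale p (unit_vec j) | p. p \<in> initial_ideal lt (I j)})"
  proof (rule is_direct_sum_coordinates)
    show "v \<in> initial_module lt C \<longleftrightarrow> Poly_Mapping.keys v \<subseteq> {1..m} \<and>
        (\<forall>j\<in>{1..m}. Poly_Mapping.lookup v j \<in> initial_ideal lt (I j))" for v
      unfolding assms(6) initial_module_of_relations_iff[OF assms(7)] using assms(8) by simp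
    show "0 \<in> initial_ideal lt (I j)" for j
      unfolding initial_ideal_eq by (rule poly_ideal.span_zero)
  qed
  moreover have "has_linear_quotients scale"
    if deg: "\<forall>G. minimal_monomial_generators m (initial_module lt C) G \<longrightarrow> (\<forall>(i, u)\<in>G. mdeg u \<le> 1)"
  proof -
    have "?A \<subseteq> {1..m} \<times> UNIV"
      by auto
    then obtain G where G: "G \<subseteq> ?A" "\<And>j u. (j, u) \<in> ?A \<Longrightarrow> \<exists>g s. (j, g) \<in> G \<and> u = g + s"
      "minimal_monomial_generators m (initial_module lt C) G"
      unfolding in_C by (rule minimal_monomial_generators_exist[where 'k = 'k]) blast
    have "generator_colon j = UNIV \<or> generated_by_linear_forms (generator_colon j)"
      if j: "j \<in> {1..m}" for j
    proof (rule linear_generation_of_almost_homogeneous_ideal[OF assms(7)])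
      show "poly_ideal.subspace (generator_colon j)"
        by (intro subspace_colon subspace_span)
      have homog: "\<exists>d. f i \<in> deg_part d" if "i \<in> {1..m}" for i
        using assms(2) that by (simp add: minimal_homogeneous_generators_def)
      obtain c where "f j \<in> deg_part c"
        using homog j by blast
      moreover have "\<exists>e. b \<in> deg_part e" if "b \<in> f ` {1..<j}" for b
        using that homog j by fastforce
      ultimately show "almost_homogeneous (generator_colon j)"
        by (intro almost_homogeneous_colon) auto
      fix u assume "u \<in> lead_monoms lt (generator_colon j)"
      then obtain g s where g: "(j, g) \<in> G" "u = g + s"
        using G(2)[of j u] j assms(8) by auto
      have "g \<in> lead_monoms lt (generator_colon j)"
        using g(1) G(1) assms(8)[OF j] by auto
      moreover have "mdeg g \<le> 1"
        using g(1) G(3) deg by fastforce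
      ultimately show "\<exists>g s. g \<in> lead_monoms lt (generator_colon j) \<and> u = g + s \<and> mdeg g \<le> 1"
        using g(2) by blast
    qed
    then have "linear_quotients_wrt scale m f"
      unfolding linear_quotients_wrt_def by (rule ballI)
    moreover have "span (f ` {1..m}) = UNIV"
      using assms(2) by (simp add: minimal_homogeneous_generators_def)
    ultimately show ?thesis
      unfolding has_linear_quotients_def by (intro exI conjI)
  qed
  ultimately show ?thesis
    by blast
qed

end
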